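(* Let $(\mathfrak{g},[\cdot,\cdot],\phi_{\mathfrak{g}},\langle\cdot,\cdot\rangle,J)$ be a Kähler hom-Lie algebra, let $\Omega(u,v)=\langle(\phi_{\mathfrak{g}}\circ J)u,v\rangle$, and let $\mathbf{a}:\mathfrak{g}\times\mathfrak{g}\to\mathfrak{g}$ be the bilinear product determined by $$\Omega(\mathbf{a}(u,v),\phi_{\mathfrak{g}}(w))=-\Omega(\phi_{\mathfrak{g}}(v),[u,w]),\qquad u,v,w\in\mathfrak{g}.$$ Then: 1. $(\mathfrak{g},\mathbf{a},\phi_{\mathfrak{g}})$ is a hom-left-symmetric algebra. 2. $(\mathfrak{g}\oplus\mathfrak{g}^*,\mathbf{a},\Phi)$ is a hom-left-symmetric algebra, where $\mathfrak{g}^*$ is the dual space of $\mathfrak{g}$ and $$\mathbf{a}\big((u,a^* ),(v,b^* )\big)=\big(\mathbf{a}(u,v),\widetilde{L}_{\phi_{\mathfrak g}(u)}b^*\big),\qquad \Phi(u,a^* )=(\phi_{\mathfrak{g}}(u),\phi_{\mathfrak{g}}^*(a^* )).$$ 3. $\mathfrak{g}\oplus\mathfrak{g}^*$, with the commutator bracket of the product in 2, the map $\Phi$, and the form $\Omega_{\mathfrak{g}\oplus\mathfrak{g}^*}\big((u,a^* ),(v,b^* )\big)=b^*(u)-a^*(v)$, is a phase space of the hom-Lie algebra $\mathfrak{g}$.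
   Context: All vector spaces are real. A hom-Lie algebra is a triple $(\mathfrak{g},[\cdot,\cdot],\phi)$ with $[\cdot,\cdot]$ bilinear and skew ($[u,v]=-[v,u]$), $\phi$ linear with $\phi([u,v])=[\phi(u),\phi(v)]$, and $[\phi(u),[v,w]]+[\phi(v),[w,u]]+[\phi(w),[u,v]]=0$; it is regular if $\phi$ is invertible and involutive if $\phi^2=\mathrm{Id}$. A pseudo-Riemannian hom-Lie algebra is a finite-dimensional hom-Lie algebra with a symmetric non-degenerate bilinear form $\langle\cdot,\cdot\rangle$ such that $\langle\phi(u),\phi(v)\rangle=\langle u,v\rangle$. When $\phi$ is an isomorphism, the hom-Levi-Civita product is the unique product $\cdot$ on $\mathfrak{g}$ with $[u,v]=u\cdot v-v\cdot u$ and $\langle u\cdot v,\phi(w)\rangle=-\langle\phi(v),u\cdot w\rangle$; equivalently $2\langle u\cdot v,\phi(w)\rangle=\langle[u,v],\phi(w)\rangle+\langle[w,v],\phi(u)\rangle+\langle[w,u],\phi(v)\rangle$. An almost complex structure on an involutive hom-Lie algebra is a linear isomorphism $J$ with $J^2=-\mathrm{Id}$, $\phi\circ J=J\circ\phi$. A Kähler hom-Lie algebra is an (involutive) pseudo-Riemannian hom-Lie algebra with an almost complex structure $J$ satisfying $\langle(\phi\circ J)u,(\phi\circ J)v\rangle=\langle u,v\rangle$ and $u\cdot(\phi\circ J)(v)=(\phi\circ J)(u\cdot v)$ for all $u,v$, where $\cdot$ is the hom-Levi-Civita product. A hom-algebra is a vector space with a bilinear product $\ast$ and a linear map $\phi$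 with $\phi(u\ast v)=\phi(u)\ast\phi(v)$; it is hom-left-symmetric if $(u\ast v)\ast\phi(w)-\phi(u)\ast(v\ast w)=(v\ast u)\ast\phi(w)-\phi(v)\ast(u\ast w)$. Its commutator is $u\ast v-v\ast u$. Elements of $\mathfrak{g}^*$ are written $a^*,b^*$; $\phi^*(a^* )=a^*\circ\phi$; and $(\widetilde{L}_u a^* )(v)=-a^*(\mathbf{a}(u,v))$. A symplectic structure on a regular hom-Lie algebra is a skew-symmetric non-degenerate bilinear form $\omega$ with $\omega([u,v],\phi(w))+\omega([w,u],\phi(v))+\omega([v,w],\phi(u))=0$ and $\omega(\phi(u),\phi(v))=\omega(u,v)$. A phase space of a hom-Lie algebra $(\mathfrak{g},[\cdot,\cdot],\phi)$ is a hom-Lie algebra structure on $\mathfrak{g}\oplus\mathfrak{g}^*$ with structure map $\phi\oplus\phi^*$ for which the form $\omega\big((u,a^* ),(v,b^* )\big)=b^*(u)-a^*(v)$ is a symplectic structure. *)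

theory Defs
  imports "HOL-Analysis.Analysis"
begin

text \<open>The underlying real vector space is the whole type; finite dimension is required only where
  a metric is present.\<close>

definition hom_lie_algebra ::
  "('a::real_vector \<Rightarrow> 'a \<Rightarrow> 'a) \<Rightarrow> ('a \<Rightarrow> 'a) \<Rightarrow> bool" where
  "hom_lie_algebra br \<phi> \<longleftrightarrow>
     bilinear br \<and> (\<forall>u v. br u v = - br v u) \<and>
     linear \<phi> \<and> (\<forall>u v. \<phi> (br u v) = br (\<phi> u) (\<phi> v)) \<and>
     (\<forall>u v w. br (\<phi> u) (br v w) + br (\<phi> v) (br w u) + br (\<phi> w) (br u v) = 0)"

definition regular_hom_lie_algebra ::
  "('a::real_vector \<Rightarrow> 'a \<Rightarrow> 'a) \<Rightarrow> ('a \<Rightarrow> 'a) \<Rightarrow> bool" where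
  "regular_hom_lie_algebra br \<phi> \<longleftrightarrow> hom_lie_algebra br \<phi> \<and> bij \<phi>"

definition involutive_hom_lie_algebra ::
  "('a::real_vector \<Rightarrow> 'a \<Rightarrow> 'a) \<Rightarrow> ('a \<Rightarrow> 'a) \<Rightarrow> bool" where
  "involutive_hom_lie_algebra br \<phi> \<longleftrightarrow> hom_lie_algebra br \<phi> \<and> \<phi> \<circ> \<phi> = id"

definition nondegenerate :: "('a::real_vector \<Rightarrow> 'a \<Rightarrow> real) \<Rightarrow> bool" where
  "nondegenerate B \<longleftrightarrow> (\<forall>u. (\<forall>v. B u v = 0) \<longrightarrow> u = 0)"

definition pseudo_riemannian_hom_lie_algebra ::
  "('a::real_vector \<Rightarrow> 'a \<Rightarrow> 'a) \<Rightarrow> ('a \<Rightarrow> 'a) \<Rightarrow> ('a \<Rightarrow> 'a \<Rightarrow> real) \<Rightarrow> bool" where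
  "pseudo_riemannian_hom_lie_algebra br \<phi> g \<longleftrightarrow>
     hom_lie_algebra br \<phi> \<and> (\<exists>B. finite B \<and> span B = (UNIV :: 'a set)) \<and>
     bilinear g \<and> (\<forall>u v. g u v = g v u) \<and> nondegenerate g \<and>
     (\<forall>u v. g (\<phi> u) (\<phi> v) = g u v)"

text \<open>The description singles out a unique product only when \<open>\<phi>\<close> is an isomorphism (and the metric
  is non-degenerate, in finite dimension).\<close>

definition hom_levi_civita ::
  "('a::real_vector \<Rightarrow> 'a \<Rightarrow> 'a) \<Rightarrow> ('a \<Rightarrow> 'a) \<Rightarrow> ('a \<Rightarrow> 'a \<Rightarrow> real) \<Rightarrow> 'a \<Rightarrow> 'a \<Rightarrow> 'a" where
  "hom_levi_civita br \<phi> g =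
     (THE p. bilinear p \<and> (\<forall>u v. br u v = p u v - p v u) \<and>
             (\<forall>u v w. g (p u v) (\<phi> w) = - g (\<phi> v) (p u w)))"

definition almost_complex_structure ::
  "('a::real_vector \<Rightarrow> 'a) \<Rightarrow> ('a \<Rightarrow> 'a) \<Rightarrow> bool" where
  "almost_complex_structure \<phi> J \<longleftrightarrow>
     linear J \<and> bij J \<and> (\<forall>u. J (J u) = - u) \<and> \<phi> \<circ> J = J \<circ> \<phi>"

definition kahler_hom_lie_algebra ::
  "('a::real_vector \<Rightarrow> 'a \<Rightarrow> 'a) \<Rightarrow> ('a \<Rightarrow> 'a) \<Rightarrow> ('a \<Rightarrow> 'a \<Rightarrow> real) \<Rightarrow> ('a \<Rightarrow> 'a) \<Rightarrow> bool" where
  "kahler_hom_lie_algebra br \<phi> g J \<longleftrightarrow>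
     involutive_hom_lie_algebra br \<phi> \<and> pseudo_riemannian_hom_lie_algebra br \<phi> g \<and>
     almost_complex_structure \<phi> J \<and>
     (\<forall>u v. g ((\<phi> \<circ> J) u) ((\<phi> \<circ> J) v) = g u v) \<and>
     (\<forall>u v. hom_levi_civita br \<phi> g u ((\<phi> \<circ> J) v) = (\<phi> \<circ> J) (hom_levi_civita br \<phi> g u v))"

definition kahler_form ::
  "('a \<Rightarrow> 'a) \<Rightarrow> ('a \<Rightarrow> 'a \<Rightarrow> real) \<Rightarrow> ('a \<Rightarrow> 'a) \<Rightarrow> 'a \<Rightarrow> 'a \<Rightarrow> real" where
  "kahler_form \<phi> g J u v = g ((\<phi> \<circ> J) u) v"

definition symplectic_structure ::
  "('a::real_vector \<Rightarrow> 'a \<Rightarrow> 'a) \<Rightarrow> ('a \<Rightarrow> 'a) \<Rightarrow> ('a \<Rightarrow> 'a \<Rightarrow> real) \<Rightarrow> bool" where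
  "symplectic_structure br \<phi> \<omega> \<longleftrightarrow>
     regular_hom_lie_algebra br \<phi> \<and>
     bilinear \<omega> \<and> (\<forall>u v. \<omega> u v = - \<omega> v u) \<and> nondegenerate \<omega> \<and>
     (\<forall>u v w. \<omega> (br u v) (\<phi> w) + \<omega> (br w u) (\<phi> v) + \<omega> (br v w) (\<phi> u) = 0) \<and>
     (\<forall>u v. \<omega> (\<phi> u) (\<phi> v) = \<omega> u v)"

definition hom_algebra ::
  "('a::real_vector \<Rightarrow> 'a \<Rightarrow> 'a) \<Rightarrow> ('a \<Rightarrow> 'a) \<Rightarrow> bool" where
  "hom_algebra p \<phi> \<longleftrightarrow> bilinear p \<and> linear \<phi> \<and> (\<forall>u v. \<phi> (p u v) = p (\<phi> u) (\<phi> v))"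

definition hom_left_symmetric_algebra ::
  "('a::real_vector \<Rightarrow> 'a \<Rightarrow> 'a) \<Rightarrow> ('a \<Rightarrow> 'a) \<Rightarrow> bool" where
  "hom_left_symmetric_algebra p \<phi> \<longleftrightarrow> hom_algebra p \<phi> \<and>
     (\<forall>u v w. p (p u v) (\<phi> w) - p (\<phi> u) (p v w) = p (p v u) (\<phi> w) - p (\<phi> v) (p u w))"

definition commutator :: "('a::real_vector \<Rightarrow> 'a \<Rightarrow> 'a) \<Rightarrow> 'a \<Rightarrow> 'a \<Rightarrow> 'a" where
  "commutator p u v = p u v - p v u"

typedef (overloaded) 'a dual = "{f :: 'a::real_vector \<Rightarrow> real. linear f}"
  morphisms dual_apply Abs_dual
  by (auto intro: linear_zero)

setup_lifting type_definition_dual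

instantiation dual :: (real_vector) real_vector
begin

lift_definition zero_dual :: "'a dual" is "\<lambda>_. 0"
  by (rule linear_zero)

lift_definition plus_dual :: "'a dual \<Rightarrow> 'a dual \<Rightarrow> 'a dual" is "\<lambda>f h v. f v + h v"
  by (rule linear_compose_add)

lift_definition minus_dual :: "'a dual \<Rightarrow> 'a dual \<Rightarrow> 'a dual" is "\<lambda>f h v. f v - h v"
  by (rule linear_compose_sub)

lift_definition uminus_dual :: "'a dual \<Rightarrow> 'a dual" is "\<lambda>f v. - f v"
  by (rule linear_compose_neg)

lift_definition scaleR_dual :: "real \<Rightarrow> 'a dual \<Rightarrow> 'a dual" is "\<lambda>c f v. c * f v"
  using linear_compose_scale_right by fastforce

instance
  by standard (transfer; simp add: fun_eq_iff algebra_simps)+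

end

lemma linear_dual_apply: "linear (dual_apply f)"
  using dual_apply by blast

lemma dual_apply_Abs [simp]: "linear f \<Longrightarrow> dual_apply (Abs_dual f) = f"
  by (simp add: Abs_dual_inverse)

text \<open>\<open>Abs_dual f\<close> is meaningful only for linear \<open>f\<close>; hence the next two operations are used for linear
  \<open>\<phi>\<close> and bilinear \<open>p\<close> only.\<close>

definition dual_map :: "('a::real_vector \<Rightarrow> 'a) \<Rightarrow> 'a dual \<Rightarrow> 'a dual" where
  "dual_map \<phi> f = Abs_dual (dual_apply f \<circ> \<phi>)"

definition dual_left_mult ::
  "('a::real_vector \<Rightarrow> 'a \<Rightarrow> 'a) \<Rightarrow> 'a \<Rightarrow> 'a dual \<Rightarrow> 'a dual" where
  "dual_left_mult p u f = Abs_dual (\<lambda>v. - dual_apply f (p u v))"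

definition sum_map ::
  "('a::real_vector \<Rightarrow> 'a) \<Rightarrow> 'a \<times> 'a dual \<Rightarrow> 'a \<times> 'a dual" where
  "sum_map \<phi> = map_prod \<phi> (dual_map \<phi>)"

definition sum_product ::
  "('a::real_vector \<Rightarrow> 'a \<Rightarrow> 'a) \<Rightarrow> ('a \<Rightarrow> 'a) \<Rightarrow>
    'a \<times> 'a dual \<Rightarrow> 'a \<times> 'a dual \<Rightarrow> 'a \<times> 'a dual" where
  "sum_product p \<phi> x y =
     (p (fst x) (fst y), dual_left_mult p (\<phi> (fst x)) (snd y))"

definition canonical_form :: "'a::real_vector \<times> 'a dual \<Rightarrow> 'a \<times> 'a dual \<Rightarrow> real" where
  "canonical_form x y = dual_apply (snd y) (fst x) - dual_apply (snd x) (fst y)"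

definition phase_space ::
  "('a::real_vector \<Rightarrow> 'a \<Rightarrow> 'a) \<Rightarrow> ('a \<Rightarrow> 'a) \<Rightarrow>
    ('a \<times> 'a dual \<Rightarrow> 'a \<times> 'a dual \<Rightarrow> 'a \<times> 'a dual) \<Rightarrow> bool" where
  "phase_space br \<phi> br' \<longleftrightarrow>
     hom_lie_algebra br \<phi> \<and> hom_lie_algebra br' (sum_map \<phi>) \<and>
     symplectic_structure br' (sum_map \<phi>) canonical_form"

definition determined_product ::
  "('a::real_vector \<Rightarrow> 'a \<Rightarrow> 'a) \<Rightarrow> ('a \<Rightarrow> 'a) \<Rightarrow> ('a \<Rightarrow> 'a \<Rightarrow> real) \<Rightarrow> ('a \<Rightarrow> 'a \<Rightarrow> 'a) \<Rightarrow> bool" where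
  "determined_product br \<phi> \<Omega> p \<longleftrightarrow>
     bilinear p \<and> (\<forall>u v w. \<Omega> (p u v) (\<phi> w) = - \<Omega> (\<phi> v) (br u w))"

end

theory Submission
  imports Defs
begin

text \<open>Let \<open>K = \<phi> \<circ> J\<close>. Since \<open>\<phi>\<close> is an involution commuting with \<open>J\<close>, also \<open>K\<^sup>2 = - Id\<close>, so the
  isometry \<open>K\<close> is skew-adjoint for the metric and the Kaehler form \<open>\<Omega>(u,v) = \<langle>K u, v\<rangle>\<close> is skew and
  non-degenerate. That \<open>\<Omega>\<close> is closed comes from the Levi-Civita product: metric compatibility and
  \<open>u \<cdot> K v = K (u \<cdot> v)\<close> together say \<open>\<Omega>(u \<cdot> v, \<phi> w) = \<Omega>(u \<cdot> w, \<phi> v)\<close>, and for a product with this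
  symmetry the cyclic sum of \<open>\<Omega>([u,v], \<phi> w)\<close> cancels in pairs
  (\<open>closed_form_if_multiplications_symmetric\<close>). Hence \<open>\<Omega>\<close> is a symplectic structure.

  From here on only \<open>\<Omega>\<close> and the involution \<open>\<phi>\<close> matter. The product \<open>a\<close> exists because a
  non-degenerate form on a finite-dimensional space represents every linear functional. Its
  defining equation says that \<open>a(u,\<cdot>)\<close> is, up to \<open>\<phi>\<close> and sign, the \<open>\<Omega>\<close>-adjoint of \<open>[u,\<cdot>]\<close>. So
  closedness of \<open>\<Omega>\<close> becomes the statement that the commutator of \<open>a\<close> is the given bracket, and the
  hom-Jacobi identity becomes hom-left-symmetry.

  Hom-left-symmetry says that left multiplication represents the commutator bracket; the dual
  representation, twisted by the involution \<open>\<phi>\<close>, gives the product on \<open>V \<oplus> V*\<close>, where \<open>V\<close> is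
  the space underlying the algebra. Its commutator is a
  hom-Lie bracket for formal reasons, and the canonical form is closed by the same cancellation as
  above, because left multiplications on \<open>V \<oplus> V*\<close> have the same symmetry with respect to it.\<close>

section \<open>Representation of functionals by non-degenerate forms\<close>

lemma nondegenerate_eqI:
  fixes B :: "'a::real_vector \<Rightarrow> 'a \<Rightarrow> real"
  assumes "bilinear B" "nondegenerate B" "surj \<phi>" "\<And>w. B u (\<phi> w) = B v (\<phi> w)"
  shows "u = v"
proof -
  have "B (u - v) w = 0" for w
    using assms(4)[of "inv \<phi> w"] bilinear_lsub[OF assms(1)] by (simp add: surj_f_inv_f[OF assms(3)])
  then show ?thesis
    using assms(2) by (metis nondegenerate_def right_minus_eq)
qed

text \<open>On a basis \<open>D\<close>, the endomorphism \<open>u \<mapsto> (\<Sum>d\<in>D. B u d *\<^sub>R d)\<close> is injective by non-degeneracy,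
  hence surjective; a preimage of \<open>\<Sum>d\<in>D. f d *\<^sub>R d\<close> represents \<open>f\<close>.\<close>

lemma nondegenerate_represents:
  fixes B :: "'a::real_vector \<Rightarrow> 'a \<Rightarrow> real"
  assumes fin: "finite S" "span S = (UNIV :: 'a set)"
    and B: "bilinear B" "nondegenerate B" and f: "linear f"
  shows "\<exists>u. \<forall>v. B u v = f v"
proof -
  obtain D where D: "D \<subseteq> S" "independent D" "span D = (UNIV :: 'a set)"
    using maximal_independent_subset[of S] fin(2) by (metis span_mono span_span top.extremum_uniqueI)
  have finD: "finite D"
    using D(1) fin(1) finite_subset by blast
  interpret fd: finite_dimensional_vector_space "scaleR :: real \<Rightarrow> 'a \<Rightarrow> 'a" D
    by unfold_locales
      (use finD D in \<open>auto simp: dependent_raw_def span_raw_def scaleR_add_right scaleR_add_left\<close>)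
  have linB: "linear (\<lambda>u. B u d)" "linear (B u)" for d u
    using B(1) by (auto simp: bilinear_def)
  define T where "T u = (\<Sum>d\<in>D. B u d *\<^sub>R d)" for u
  have linT: "linear T"
    by (rule linearI)
      (auto simp: T_def linear_add[OF linB(1)] linear_scale[OF linB(1)] scaleR_add_left
        sum.distrib scaleR_sum_right)
  have coeff_unique: "\<forall>d\<in>D. c d = e d"
    if "(\<Sum>d\<in>D. c d *\<^sub>R d) = (\<Sum>d\<in>D. e d *\<^sub>R d)" for c e :: "'a \<Rightarrow> real"
  proof -
    have "(\<Sum>d\<in>D. (c d - e d) *\<^sub>R d) = 0"
      using that by (simp add: scaleR_diff_left sum_subtractf)
    then show ?thesis
      using D(2) finD independentD[of D D "\<lambda>d. c d - e d"] by auto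
  qed
  have eq_on_D: "B u v = h v" if "\<forall>d\<in>D. B u d = h d" "linear h" for u v h
    using linear_eq_on_span[OF linB(2)[of u] that(2), of D v] that(1) D(3) by auto
  have "inj T"
  proof (rule iffD2[OF linear_injective_0[OF linT]], intro allI impI)
    fix u assume "T u = 0"
    then have "\<forall>d\<in>D. B u d = 0"
      using coeff_unique[of "B u" "\<lambda>_. 0"] by (simp add: T_def)
    then have "\<forall>v. B u v = 0"
      using eq_on_D[of u "\<lambda>_. 0"] linear_zero by blast
    then show "u = 0"
      using B(2) by (simp add: nondegenerate_def)
  qed
  then have "surj T"
    using fd.linear_inj_imp_surj[OF linT[unfolded linear_def]] by simp
  then obtain u where "T u = (\<Sum>d\<in>D. f d *\<^sub>R d)"
    by (metis surjD)
  then have "\<forall>d\<in>D. B u d = f d"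
    using coeff_unique[of "B u" f] by (simp add: T_def)
  then show ?thesis
    using eq_on_D f by blast
qed

text \<open>The existence half of a definition of a product by its pairings against \<open>\<phi> w\<close>; uniqueness
  of the representing vector makes the product bilinear.\<close>

lemma bilinear_product_exists:
  fixes B :: "'a::real_vector \<Rightarrow> 'a \<Rightarrow> real" and F :: "'a \<Rightarrow> 'a \<Rightarrow> 'a \<Rightarrow> real"
  assumes fin: "finite S" "span S = (UNIV :: 'a set)"
    and B: "bilinear B" "nondegenerate B" and \<phi>: "linear \<phi>" "bij \<phi>"
    and F: "\<And>u v. linear (F u v)" "\<And>u w. linear (\<lambda>v. F u v w)" "\<And>v w. linear (\<lambda>u. F u v w)"
  shows "\<exists>p. bilinear p \<and> (\<forall>u v w. B (p u v) (\<phi> w) = F u v w)"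
proof -
  have inv_lin: "linear (inv \<phi>)"
    by (intro linearI inv_f_eq[OF bij_is_inj[OF \<phi>(2)]])
      (simp_all add: linear_add[OF \<phi>(1)] linear_scale[OF \<phi>(1)]
        surj_f_inv_f[OF bij_is_surj[OF \<phi>(2)]])
  have "\<exists>x. \<forall>w. B x w = F u v (inv \<phi> w)" for u v
    using nondegenerate_represents[OF fin B linear_compose[OF inv_lin F(1)[of u v]]] by simp
  then obtain p where "\<And>u v w. B (p u v) w = F u v (inv \<phi> w)"
    by metis
  then have p: "\<And>u v w. B (p u v) (\<phi> w) = F u v w"
    by (simp add: bij_is_inj[OF \<phi>(2)])
  note eqI = nondegenerate_eqI[OF B bij_is_surj[OF \<phi>(2)]]
  have "bilinear p"
    unfolding bilinear_def
    by (intro conjI allI linearI; rule eqI)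
      (simp_all add: p bilinear_ladd[OF B(1)] bilinear_lmul[OF B(1)]
        linear_add[OF F(2)] linear_add[OF F(3)] linear_scale[OF F(2)] linear_scale[OF F(3)])
  with p show ?thesis by blast
qed

section \<open>The hom-Levi-Civita product\<close>

text \<open>Permuting the arguments in the two defining properties yields the Koszul formula, which
  both determines the product and, read as a definition, produces it.\<close>

lemma hom_levi_civita_properties:
  fixes br :: "'a::real_vector \<Rightarrow> 'a \<Rightarrow> 'a"
  assumes R: "pseudo_riemannian_hom_lie_algebra br \<phi> g" and bij: "bij \<phi>"
  defines "p \<equiv> hom_levi_civita br \<phi> g"
  shows "bilinear p" "br u v = p u v - p v u" "g (p u v) (\<phi> w) = - g (\<phi> v) (p u w)"
proof -
  obtain S where fin: "finite S" "span S = (UNIV :: 'a set)"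
    using R unfolding pseudo_riemannian_hom_lie_algebra_def by blast
  have g: "bilinear g" "nondegenerate g" and sym: "\<And>u v. g u v = g v u"
    and br: "bilinear br" "\<And>u v. br u v = - br v u" and \<phi>: "linear \<phi>"
    \<comment> \<open>Skew-symmetry loops as a rewrite rule, so the conjuncts are extracted by elimination only.\<close>
    using R unfolding pseudo_riemannian_hom_lie_algebra_def hom_lie_algebra_def
    by - (elim conjE allE; assumption)+
  note lins = bilinear_ladd[OF g(1)] bilinear_radd[OF g(1)] bilinear_lmul[OF g(1)]
    bilinear_rmul[OF g(1)] bilinear_ladd[OF br(1)] bilinear_radd[OF br(1)]
    bilinear_lmul[OF br(1)] bilinear_rmul[OF br(1)] linear_add[OF \<phi>] linear_scale[OF \<phi>]
  define F where "F u v w = (g (br u v) (\<phi> w) + g (br w v) (\<phi> u) + g (br w u) (\<phi> v)) / 2" for u v w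
  have "\<exists>q. bilinear q \<and> (\<forall>u v w. g (q u v) (\<phi> w) = F u v w)"
    by (rule bilinear_product_exists[OF fin g \<phi> bij];
        rule linearI; simp add: F_def lins field_simps)
  then obtain q where q: "bilinear q" "\<And>u v w. g (q u v) (\<phi> w) = F u v w"
    by blast
  note eqI = nondegenerate_eqI[OF g bij_is_surj[OF bij]]
  let ?P = "\<lambda>p. bilinear p \<and> (\<forall>u v. br u v = p u v - p v u) \<and>
             (\<forall>u v w. g (p u v) (\<phi> w) = - g (\<phi> v) (p u w))"
  have skew: "g (br u v) w = - g (br v u) w" for u v w
    using br(2)[of u v] by (simp add: bilinear_lneg[OF g(1)])
  have "br u v = q u v - q v u" for u v
    by (rule eqI) (simp add: bilinear_lsub[OF g(1)] q(2) F_def skew[of v u] field_simps)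
  moreover have "g (q u v) (\<phi> w) = - g (\<phi> v) (q u w)" for u v w
    using q(2)[of u v w] q(2)[of u w v] skew[of w v] skew[of w u] skew[of u v]
    by (simp add: sym[of "\<phi> v"] F_def field_simps)
  ultimately have Pq: "?P q"
    using q(1) by blast
  have "r = q" if "?P r" for r
  proof (intro ext eqI)
    fix u v w
    have c: "\<And>u v. br u v = r u v - r v u"
      using that by blast
    have m: "g (r u v) (\<phi> w) = - g (r u w) (\<phi> v)" for u v w
      using that sym[of "\<phi> v" "r u w"] by metis
    show "g (r u v) (\<phi> w) = g (q u v) (\<phi> w)"
      using m[of u v w] m[of v u w] m[of w u v]
      by (simp add: q(2) F_def c bilinear_lsub[OF g(1)])
  qed
  then have "?P p"
    unfolding p_def hom_levi_civita_def using theI[of ?P, OF Pq] by blast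
  then show "bilinear p" "br u v = p u v - p v u" "g (p u v) (\<phi> w) = - g (\<phi> v) (p u w)"
    by blast+
qed

section \<open>The Kaehler form is symplectic\<close>

text \<open>For skew \<open>\<omega>\<close> the symmetry says that left multiplications are, up to \<open>\<phi>\<close>, infinitesimally
  symplectic; it is what the Kaehler form and the canonical form have in common. Expanding the commutators, the six terms of the cyclic sum then cancel in pairs.\<close>

lemma closed_form_if_multiplications_symmetric:
  assumes "bilinear \<omega>" "\<And>x y z. \<omega> (p x y) (\<phi> z) = \<omega> (p x z) (\<phi> y)"
  shows "\<omega> (commutator p x y) (\<phi> z) + \<omega> (commutator p z x) (\<phi> y) + \<omega> (commutator p y z) (\<phi> x) = 0"
  using assms(2)[of x y z] assms(2)[of y x z] assms(2)[of z x y]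
  by (simp add: commutator_def bilinear_lsub[OF assms(1)])

lemma kahler_form_symplectic:
  assumes K: "kahler_hom_lie_algebra br \<phi> g J"
  shows "symplectic_structure br \<phi> (kahler_form \<phi> g J)"
proof -
  define K where "K = \<phi> \<circ> J"
  have R: "pseudo_riemannian_hom_lie_algebra br \<phi> g" and H: "hom_lie_algebra br \<phi>"
    and inv: "\<phi> \<circ> \<phi> = id" and linJ: "linear J" and JJ: "\<And>u. J (J u) = - u"
    and comm: "\<phi> \<circ> J = J \<circ> \<phi>" and gK: "\<And>u v. g (K u) (K v) = g u v"
    and pK: "\<And>u v. hom_levi_civita br \<phi> g u (K v) = K (hom_levi_civita br \<phi> g u v)"
    using K unfolding kahler_hom_lie_algebra_def involutive_hom_lie_algebra_def
      almost_complex_structure_def K_def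
    by - (elim conjE allE; assumption)+
  have g: "bilinear g" "nondegenerate g" and sym: "\<And>u v. g u v = g v u"
    and g\<phi>: "\<And>u v. g (\<phi> u) (\<phi> v) = g u v" and \<phi>: "linear \<phi>"
    using R unfolding pseudo_riemannian_hom_lie_algebra_def hom_lie_algebra_def
    by - (elim conjE allE; assumption)+
  have bij: "bij \<phi>"
    using inv o_bij by blast
  have linK: "linear K"
    unfolding K_def by (rule linear_compose[OF linJ \<phi>])
  have inv': "\<phi> (\<phi> u) = u" and comm': "\<phi> (J u) = J (\<phi> u)" for u
    using inv comm by (auto simp: fun_eq_iff)
  have K\<phi>: "\<phi> (K u) = K (\<phi> u)" for u
    by (simp add: K_def comm')
  have KK: "K (K u) = - u" for u
    by (simp add: K_def comm' inv' JJ linear_neg[OF \<phi>])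
  have form: "kahler_form \<phi> g J = (\<lambda>u v. g (K u) v)"
    by (simp add: fun_eq_iff kahler_form_def K_def)
  have adj: "g (K u) v = - g u (K v)" for u v
    using gK[of u "K v"] by (simp add: KK bilinear_rneg[OF g(1)])
  have bil: "bilinear (\<lambda>u v. g (K u) v)"
    unfolding bilinear_def
    by (auto intro!: linearI simp: linear_add[OF linK] linear_scale[OF linK] bilinear_ladd[OF g(1)]
        bilinear_radd[OF g(1)] bilinear_lmul[OF g(1)] bilinear_rmul[OF g(1)])
  have nondeg: "nondegenerate (\<lambda>u v. g (K u) v)"
    unfolding nondegenerate_def
  proof (intro allI impI)
    fix u assume "\<forall>v. g (K u) v = 0"
    then have "K u = 0"
      using g(2) by (simp add: nondegenerate_def)
    then show "u = 0"
      using KK[of u] linear_0[OF linK] by simp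
  qed
  let ?p = "hom_levi_civita br \<phi> g"
  note LC = hom_levi_civita_properties[OF R bij]
  have symm: "g (K (?p u v)) (\<phi> w) = g (K (?p u w)) (\<phi> v)" for u v w
  proof -
    have "g (K (?p u v)) (\<phi> w) = - g (\<phi> (K v)) (?p u w)"
      by (simp add: LC(3) flip: pK)
    also have "\<dots> = g (K (?p u w)) (\<phi> v)"
      by (simp add: K\<phi> adj sym[of "\<phi> v"])
    finally show ?thesis .
  qed
  have br: "br = commutator ?p"
    by (simp add: fun_eq_iff commutator_def flip: LC(2))
  show ?thesis
    unfolding symplectic_structure_def form regular_hom_lie_algebra_def
  proof (intro conjI allI)
    fix u v w
    show "g (K u) v = - g (K v) u"
      by (simp add: adj[of u] sym[of u])
    show "g (K (br u v)) (\<phi> w) + g (K (br w u)) (\<phi> v) + g (K (br v w)) (\<phi> u) = 0"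
      using closed_form_if_multiplications_symmetric[where p = ?p and \<phi> = \<phi>, OF bil symm,
          where x = u and y = v and z = w] by (simp flip: br)
    show "g (K (\<phi> u)) (\<phi> v) = g (K u) v"
      by (simp add: g\<phi> flip: K\<phi>)
  qed (fact H bij bil nondeg)+
qed

section \<open>The product determined by a symplectic structure\<close>

lemma determined_product_ex1:
  fixes br :: "'a::real_vector \<Rightarrow> 'a \<Rightarrow> 'a"
  assumes fin: "finite S" "span S = (UNIV :: 'a set)" and S: "symplectic_structure br \<phi> \<omega>"
  shows "\<exists>!a. determined_product br \<phi> \<omega> a"
proof -
  have w: "bilinear \<omega>" "nondegenerate \<omega>" and \<phi>: "linear \<phi>" "bij \<phi>" and br: "bilinear br"
    using S unfolding symplectic_structure_def regular_hom_lie_algebra_def hom_lie_algebra_def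
    by - (elim conjE allE; assumption)+
  have "\<exists>a. determined_product br \<phi> \<omega> a"
    unfolding determined_product_def
    by (rule bilinear_product_exists[OF fin w \<phi>]; rule linearI)
      (simp_all add: bilinear_ladd[OF w(1)] bilinear_radd[OF w(1)] bilinear_lmul[OF w(1)]
        bilinear_rmul[OF w(1)] bilinear_ladd[OF br] bilinear_radd[OF br] bilinear_lmul[OF br]
        bilinear_rmul[OF br] linear_add[OF \<phi>(1)] linear_scale[OF \<phi>(1)])
  moreover have "a = b" if "determined_product br \<phi> \<omega> a" "determined_product br \<phi> \<omega> b" for a b
    using that by (intro ext nondegenerate_eqI[OF w bij_is_surj[OF \<phi>(2)]])
      (simp add: determined_product_def)
  ultimately show ?thesis by blast
qed

text \<open>Paired with \<open>\<phi> w\<close>, the claim is precisely the closedness of \<open>\<omega>\<close>.\<close>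

lemma determined_product_commutator:
  assumes S: "symplectic_structure br \<phi> \<omega>" and a: "determined_product br \<phi> \<omega> a"
  shows "commutator a = br"
proof (rule ext, rule ext, rule nondegenerate_eqI)
  show w: "bilinear \<omega>" "nondegenerate \<omega>"
    using S unfolding symplectic_structure_def by - (elim conjE; assumption)+
  show "surj \<phi>"
    using S unfolding symplectic_structure_def regular_hom_lie_algebra_def
    by (elim conjE, intro bij_is_surj)
  have skew: "\<And>u v. \<omega> u v = - \<omega> v u" and brskew: "\<And>u v. br u v = - br v u"
    and closed: "\<And>u v w. \<omega> (br u v) (\<phi> w) + \<omega> (br w u) (\<phi> v) + \<omega> (br v w) (\<phi> u) = 0"
    using S unfolding symplectic_structure_def regular_hom_lie_algebra_def hom_lie_algebra_def
    by - (elim conjE allE; assumption)+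
  fix u v w
  note closed[of u v w]
  moreover have "\<omega> (br w u) (\<phi> v) = \<omega> (\<phi> v) (br u w)"
    using brskew[of w u] skew[of "br u w"] by (simp add: bilinear_lneg[OF w(1)])
  moreover have "\<omega> (br v w) (\<phi> u) = - \<omega> (\<phi> u) (br v w)"
    by (rule skew)
  ultimately show "\<omega> (commutator a u v) (\<phi> w) = \<omega> (br u v) (\<phi> w)"
    using a by (simp add: commutator_def determined_product_def bilinear_lsub[OF w(1)])
qed

text \<open>Moving left multiplications across \<open>\<omega>\<close> turns hom-left-symmetry, paired with \<open>\<phi> (\<phi> x)\<close>, into
  the hom-Jacobi identity for \<open>u\<close>, \<open>v\<close>, \<open>x\<close>.\<close>

lemma determined_product_hom_left_symmetric:
  assumes S: "symplectic_structure br \<phi> \<omega>" and a: "determined_product br \<phi> \<omega> a"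
  shows "hom_left_symmetric_algebra a \<phi>"
proof -
  have w: "bilinear \<omega>" "nondegenerate \<omega>" and \<phi>: "linear \<phi>" "bij \<phi>" and br: "bilinear br"
    and w\<phi>: "\<And>u v. \<omega> (\<phi> u) (\<phi> v) = \<omega> u v" and brskew: "\<And>u v. br u v = - br v u"
    and br\<phi>: "\<And>u v. \<phi> (br u v) = br (\<phi> u) (\<phi> v)"
    and jacobi: "\<And>u v w. br (\<phi> u) (br v w) + br (\<phi> v) (br w u) + br (\<phi> w) (br u v) = 0"
    using S unfolding symplectic_structure_def regular_hom_lie_algebra_def hom_lie_algebra_def
    by - (elim conjE allE; assumption)+
  have bil: "bilinear a" and det: "\<And>u v w. \<omega> (a u v) (\<phi> w) = - \<omega> (\<phi> v) (br u w)"
    using a by (auto simp: determined_product_def)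
  have surj: "surj \<phi>" "surj (\<phi> \<circ> \<phi>)"
    using bij_is_surj[OF \<phi>(2)] comp_surj by blast+
  note eqI = nondegenerate_eqI[OF w surj(2), unfolded o_apply]
  have mult: "\<phi> (a u v) = a (\<phi> u) (\<phi> v)" for u v
    by (rule eqI) (simp add: w\<phi> det flip: br\<phi>)
  have "a (commutator a u v) (\<phi> w) = a (\<phi> u) (a v w) - a (\<phi> v) (a u w)" for u v w
  proof (rule eqI)
    fix x
    have pair: "\<omega> (a (\<phi> u) (a v w)) (\<phi> (\<phi> x)) = \<omega> (\<phi> (\<phi> w)) (br (\<phi> v) (br u x))" for u v
      by (simp add: det mult flip: br\<phi>)
    have "br (\<phi> u) (br v x) - br (\<phi> v) (br u x) = - br (\<phi> x) (br u v)"
      using jacobi[of u v x] brskew[of x u] by (simp add: bilinear_rneg[OF br] eq_neg_iff_add_eq_0)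
    then have jac: "br (br u v) (\<phi> x) = br (\<phi> u) (br v x) - br (\<phi> v) (br u x)"
      using brskew[of "br u v" "\<phi> x"] by simp
    have "\<omega> (a (commutator a u v) (\<phi> w)) (\<phi> (\<phi> x)) =
        \<omega> (\<phi> (\<phi> w)) (br (\<phi> v) (br u x)) - \<omega> (\<phi> (\<phi> w)) (br (\<phi> u) (br v x))"
      by (simp add: determined_product_commutator[OF S a] det jac bilinear_rsub[OF w(1)])
    then show "\<omega> (a (commutator a u v) (\<phi> w)) (\<phi> (\<phi> x)) =
        \<omega> (a (\<phi> u) (a v w) - a (\<phi> v) (a u w)) (\<phi> (\<phi> x))"
      by (simp only: bilinear_lsub[OF w(1)] pair)
  qed
  then have "a (a u v) (\<phi> w) - a (\<phi> u) (a v w) = a (a v u) (\<phi> w) - a (\<phi> v) (a u w)" for u v w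
    by (simp add: commutator_def bilinear_lsub[OF bil] algebra_simps)
  then show ?thesis
    using bil \<phi>(1) mult by (auto simp: hom_left_symmetric_algebra_def hom_algebra_def)
qed

section \<open>The extension to the sum with the dual space\<close>

lemma dual_eqI: "(\<And>t. dual_apply x t = dual_apply y t) \<Longrightarrow> x = y"
  by (metis dual_apply_inject ext)

lemma dual_apply_arith:
  "dual_apply (x + y) t = dual_apply x t + dual_apply y t"
  "dual_apply (x - y) t = dual_apply x t - dual_apply y t"
  "dual_apply (c *\<^sub>R x) t = c * dual_apply x t"
  "dual_apply 0 t = 0"
  by (simp_all add: plus_dual.rep_eq minus_dual.rep_eq scaleR_dual.rep_eq zero_dual.rep_eq)

lemma dual_apply_linear_arg:
  "dual_apply x (s + t) = dual_apply x s + dual_apply x t"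
  "dual_apply x (s - t) = dual_apply x s - dual_apply x t"
  "dual_apply x (c *\<^sub>R t) = c * dual_apply x t"
  by (simp_all add: linear_add[OF linear_dual_apply] linear_diff[OF linear_dual_apply]
      linear_scale[OF linear_dual_apply])

lemma dual_map_apply: "linear \<phi> \<Longrightarrow> dual_apply (dual_map \<phi> x) t = dual_apply x (\<phi> t)"
  by (simp add: dual_map_def linear_compose linear_dual_apply)

lemma dual_left_mult_apply:
  assumes "bilinear p"
  shows "dual_apply (dual_left_mult p u x) t = - dual_apply x (p u t)"
proof -
  have "linear (\<lambda>v. - dual_apply x (p u v))"
    by (rule linearI)
      (simp_all add: bilinear_radd[OF assms] bilinear_rmul[OF assms] dual_apply_linear_arg)
  then show ?thesis
    by (simp add: dual_left_mult_def)
qed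

lemma sum_map_simps [simp]:
  "fst (sum_map \<phi> x) = \<phi> (fst x)" "snd (sum_map \<phi> x) = dual_map \<phi> (snd x)"
  by (simp_all add: sum_map_def)

lemma sum_map_linear:
  assumes "linear \<phi>"
  shows "linear (sum_map \<phi>)"
  by (rule linearI; intro prod_eqI dual_eqI)
    (simp_all add: linear_add[OF assms] linear_scale[OF assms] dual_map_apply[OF assms]
      dual_apply_arith)

lemma sum_map_involution:
  assumes "linear \<phi>" "\<phi> \<circ> \<phi> = id"
  shows "sum_map \<phi> \<circ> sum_map \<phi> = id"
proof
  have "\<phi> (\<phi> u) = u" for u
    using assms(2) by (simp add: fun_eq_iff)
  then show "(sum_map \<phi> \<circ> sum_map \<phi>) x = id x" for x
    by (intro prod_eqI dual_eqI) (simp_all add: dual_map_apply[OF assms(1)])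
qed

lemma sum_product_bilinear:
  assumes a: "bilinear a" and \<phi>: "linear \<phi>"
  shows "bilinear (sum_product a \<phi>)"
  unfolding bilinear_def
  by (intro conjI allI; rule linearI; intro prod_eqI dual_eqI)
    (simp_all add: sum_product_def dual_left_mult_apply[OF a] dual_apply_arith
      dual_apply_linear_arg bilinear_ladd[OF a] bilinear_radd[OF a] bilinear_lmul[OF a]
      bilinear_rmul[OF a] linear_add[OF \<phi>] linear_scale[OF \<phi>] algebra_simps)

text \<open>Evaluating a functional transposes left multiplications, so the dual components of both
  axioms reduce to the axioms for \<open>a\<close>, up to even powers of \<open>\<phi>\<close>. For example, at \<open>t\<close>
  multiplicativity compares \<open>a (\<phi> u) (\<phi> t)\<close> with \<open>a (\<phi> (\<phi> (\<phi> u))) (\<phi> t)\<close>, so that \<open>\<phi>\<close> has to be an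
  involution.\<close>

lemma sum_product_hom_left_symmetric:
  assumes L: "hom_left_symmetric_algebra a \<phi>" and inv: "\<phi> \<circ> \<phi> = id"
  shows "hom_left_symmetric_algebra (sum_product a \<phi>) (sum_map \<phi>)"
proof -
  have a: "bilinear a" and \<phi>: "linear \<phi>" and mult: "\<And>u v. \<phi> (a u v) = a (\<phi> u) (\<phi> v)"
    and ls: "\<And>u v w. a (a u v) (\<phi> w) - a (\<phi> u) (a v w) = a (a v u) (\<phi> w) - a (\<phi> v) (a u w)"
    using L unfolding hom_left_symmetric_algebra_def hom_algebra_def
    by - (elim conjE allE; assumption)+
  have inv': "\<phi> (\<phi> u) = u" for u
    using inv by (simp add: fun_eq_iff)
  note eval = sum_product_def dual_map_apply[OF \<phi>] dual_left_mult_apply[OF a]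
  have "sum_map \<phi> (sum_product a \<phi> x y) = sum_product a \<phi> (sum_map \<phi> x) (sum_map \<phi> y)" for x y
    by (intro prod_eqI dual_eqI) (simp_all add: eval mult inv')
  moreover have "sum_product a \<phi> (sum_product a \<phi> x y) (sum_map \<phi> z)
      - sum_product a \<phi> (sum_map \<phi> x) (sum_product a \<phi> y z)
    = sum_product a \<phi> (sum_product a \<phi> y x) (sum_map \<phi> z)
      - sum_product a \<phi> (sum_map \<phi> y) (sum_product a \<phi> x z)" for x y z
  proof (intro prod_eqI dual_eqI)
    fix t
    have "dual_apply (snd z) (a (a (fst x) (fst y)) (\<phi> t) - a (\<phi> (fst x)) (a (fst y) t))
        = dual_apply (snd z) (a (a (fst y) (fst x)) (\<phi> t) - a (\<phi> (fst y)) (a (fst x) t))"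
      by (simp only: ls)
    then show "dual_apply (snd (sum_product a \<phi> (sum_product a \<phi> x y) (sum_map \<phi> z)
        - sum_product a \<phi> (sum_map \<phi> x) (sum_product a \<phi> y z))) t
      = dual_apply (snd (sum_product a \<phi> (sum_product a \<phi> y x) (sum_map \<phi> z)
        - sum_product a \<phi> (sum_map \<phi> y) (sum_product a \<phi> x z))) t"
      by (simp add: eval dual_apply_arith dual_apply_linear_arg mult inv')
  qed (simp add: sum_product_def ls)
  ultimately show ?thesis
    using sum_product_bilinear[OF a \<phi>] sum_map_linear[OF \<phi>]
    by (simp add: hom_left_symmetric_algebra_def hom_algebra_def)
qed

section \<open>The phase space\<close>

text \<open>Expanded into products, the hom-Jacobi sum splits into three defects of hom-left-symmetry,
  one for each cyclic permutation of the arguments.\<close>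

lemma commutator_hom_lie_algebra:
  assumes L: "hom_left_symmetric_algebra p \<phi>"
  shows "hom_lie_algebra (commutator p) \<phi>"
proof -
  have p: "bilinear p" and \<phi>: "linear \<phi>" and mult: "\<And>u v. \<phi> (p u v) = p (\<phi> u) (\<phi> v)"
    and ls: "\<And>u v w. p (p u v) (\<phi> w) - p (\<phi> u) (p v w) = p (p v u) (\<phi> w) - p (\<phi> v) (p u w)"
    using L unfolding hom_left_symmetric_algebra_def hom_algebra_def
    by - (elim conjE allE; assumption)+
  have "bilinear (commutator p)"
    unfolding bilinear_def
    by (intro conjI allI; rule linearI)
      (simp_all add: commutator_def bilinear_ladd[OF p] bilinear_radd[OF p] bilinear_lmul[OF p]
        bilinear_rmul[OF p] algebra_simps)
  moreover have "commutator p (\<phi> u) (commutator p v w) + commutator p (\<phi> v) (commutator p w u)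
      + commutator p (\<phi> w) (commutator p u v) = 0" for u v w
  proof -
    have "commutator p (\<phi> u) (commutator p v w) + commutator p (\<phi> v) (commutator p w u)
        + commutator p (\<phi> w) (commutator p u v)
      = ((p (p v u) (\<phi> w) - p (\<phi> v) (p u w)) - (p (p u v) (\<phi> w) - p (\<phi> u) (p v w)))
        + ((p (p w v) (\<phi> u) - p (\<phi> w) (p v u)) - (p (p v w) (\<phi> u) - p (\<phi> v) (p w u)))
        + ((p (p u w) (\<phi> v) - p (\<phi> u) (p w v)) - (p (p w u) (\<phi> v) - p (\<phi> w) (p u v)))"
      by (simp add: commutator_def bilinear_lsub[OF p] bilinear_rsub[OF p] algebra_simps)
    also have "\<dots> = 0"
      using ls[of u v w] ls[of v w u] ls[of w u v] by simp
    finally show ?thesis .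
  qed
  ultimately show ?thesis
    using \<phi> by (simp add: hom_lie_algebra_def commutator_def linear_diff[OF \<phi>] mult)
qed

lemma canonical_form_bilinear: "bilinear canonical_form"
  unfolding bilinear_def
  by (intro conjI allI; rule linearI)
    (simp_all add: canonical_form_def dual_apply_arith dual_apply_linear_arg algebra_simps)

text \<open>Non-degeneracy in the vector component needs enough linear functionals to separate vectors;
  the functionals \<open>B u\<close> suffice.\<close>

lemma canonical_form_nondegenerate:
  fixes B :: "'a::real_vector \<Rightarrow> 'a \<Rightarrow> real"
  assumes "bilinear B" "nondegenerate B" "\<And>u v. B u v = - B v u"
  shows "nondegenerate (canonical_form :: 'a \<times> 'a dual \<Rightarrow> _)"
  unfolding nondegenerate_def
proof (intro allI impI)
  fix x :: "'a \<times> 'a dual"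
  assume x: "\<forall>y. canonical_form x y = 0"
  have "linear (B w)" for w
    using assms(1) by (simp add: bilinear_def)
  then have "B w (fst x) = 0" for w
    using x[rule_format, of "(0, Abs_dual (B w))"] linear_0[OF linear_dual_apply]
    by (simp add: canonical_form_def)
  then have "fst x = 0"
    using assms(2) assms(3)[of "fst x"] by (simp add: nondegenerate_def)
  moreover have "snd x = 0"
  proof (rule dual_eqI)
    show "dual_apply (snd x) t = dual_apply 0 t" for t
      using x[rule_format, of "(t, 0)"] by (simp add: canonical_form_def dual_apply_arith)
  qed
  ultimately show "x = 0"
    by (simp add: prod_eq_iff)
qed

text \<open>With \<open>x = (u, a*)\<close>, \<open>y = (v, b*)\<close> and \<open>z = (w, c*)\<close>, both sides equal
  \<open>c* (a (\<phi> u) (\<phi> v)) + b* (a (\<phi> u) (\<phi> w))\<close>.\<close>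

lemma sum_product_multiplications_symmetric:
  assumes L: "hom_left_symmetric_algebra a \<phi>"
  shows "canonical_form (sum_product a \<phi> x y) (sum_map \<phi> z) =
    canonical_form (sum_product a \<phi> x z) (sum_map \<phi> y)"
proof -
  have "bilinear a" "linear \<phi>" "\<And>u v. \<phi> (a u v) = a (\<phi> u) (\<phi> v)"
    using L unfolding hom_left_symmetric_algebra_def hom_algebra_def
    by - (elim conjE allE; assumption)+
  then show ?thesis
    by (simp add: canonical_form_def sum_product_def dual_map_apply dual_left_mult_apply)
qed

lemma sum_product_phase_space:
  assumes S: "symplectic_structure br \<phi> \<omega>" and inv: "\<phi> \<circ> \<phi> = id"
    and L: "hom_left_symmetric_algebra a \<phi>"
  shows "phase_space br \<phi> (commutator (sum_product a \<phi>))"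
proof -
  have H: "hom_lie_algebra br \<phi>" and w: "bilinear \<omega>" "nondegenerate \<omega>" "\<And>u v. \<omega> u v = - \<omega> v u"
    using S unfolding symplectic_structure_def regular_hom_lie_algebra_def
    by - (elim conjE allE; assumption)+
  have \<phi>: "linear \<phi>"
    using H by (simp add: hom_lie_algebra_def)
  have H': "hom_lie_algebra (commutator (sum_product a \<phi>)) (sum_map \<phi>)"
    by (intro commutator_hom_lie_algebra sum_product_hom_left_symmetric L inv)
  have bij: "bij (sum_map \<phi>)"
    using sum_map_involution[OF \<phi> inv] o_bij by blast
  have inv': "\<phi> (\<phi> u) = u" for u
    using inv by (simp add: fun_eq_iff)
  have "symplectic_structure (commutator (sum_product a \<phi>)) (sum_map \<phi>) canonical_form"
    unfolding symplectic_structure_def regular_hom_lie_algebra_def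
  proof (intro conjI allI)
    fix x y z :: "'a \<times> 'a dual"
    show "canonical_form (commutator (sum_product a \<phi>) x y) (sum_map \<phi> z)
        + canonical_form (commutator (sum_product a \<phi>) z x) (sum_map \<phi> y)
        + canonical_form (commutator (sum_product a \<phi>) y z) (sum_map \<phi> x) = 0"
      by (rule closed_form_if_multiplications_symmetric[OF canonical_form_bilinear
            sum_product_multiplications_symmetric[OF L]])
    show "canonical_form (sum_map \<phi> x) (sum_map \<phi> y) = canonical_form x y"
      by (simp add: canonical_form_def dual_map_apply[OF \<phi>] inv')
    show "canonical_form x y = - canonical_form y x"
      by (simp add: canonical_form_def)
  qed (fact H' bij canonical_form_bilinear canonical_form_nondegenerate[OF w])+
  then show ?thesis
    using H H' by (simp add: phase_space_def)
qed

theorem corollary5p6: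
  fixes br :: "'a::real_vector \<Rightarrow> 'a \<Rightarrow> 'a"
    and \<phi> J :: "'a \<Rightarrow> 'a"
    and g :: "'a \<Rightarrow> 'a \<Rightarrow> real"
  assumes "kahler_hom_lie_algebra br \<phi> g J"
  shows "(\<exists>!a. determined_product br \<phi> (kahler_form \<phi> g J) a) \<and>
    (\<forall>a. determined_product br \<phi> (kahler_form \<phi> g J) a \<longrightarrow>
       hom_left_symmetric_algebra a \<phi> \<and>
       hom_left_symmetric_algebra (sum_product a \<phi>) (sum_map \<phi>) \<and>
       phase_space br \<phi> (commutator (sum_product a \<phi>)))"
proof -
  obtain S where fin: "finite S" "span S = (UNIV :: 'a set)"
    using assms by (auto simp: kahler_hom_lie_algebra_def pseudo_riemannian_hom_lie_algebra_def)
  have inv: "\<phi> \<circ> \<phi> = id"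
    using assms by (simp add: kahler_hom_lie_algebra_def involutive_hom_lie_algebra_def)
  note S = kahler_form_symplectic[OF assms]
  show ?thesis
    using determined_product_ex1[OF fin S] determined_product_hom_left_symmetric[OF S]
      sum_product_hom_left_symmetric[OF _ inv] sum_product_phase_space[OF S inv] by blast
qed

end
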